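(* Consider a Cartesian grid of $\mathbb R^2$ with cells $C_{ij}=[x_{i-\frac12},x_{i+\frac12}]\times[y_{j-\frac12},y_{j+\frac12}]$, $i,j\in\mathbb Z$, of size $\Delta x\times\Delta y$ and with centers $(x_i,y_j)$. Let real cell averages $\bar q_{ij}$ and real point values at all cell corners ($q_{i+\frac12,j+\frac12}$) and all edge midpoints ($q_{i+\frac12,j}$, $q_{i,j+\frac12}$) be given, the point values being shared by the adjacent cells. In every cell $C_{ij}$ let the reconstruction be $(x,y)\mapsto q_{\rm recon}(x-x_i,y-y_j)$, where $q_{\rm recon}$ is the limited reconstruction defined in the context, computed from the cell average $\bar q=\bar q_{ij}$ and the eight point values on the boundary of $C_{ij}$ ($q_{NE}=q_{i+\frac12,j+\frac12}$, $q_N=q_{i,j+\frac12}$, $q_{NW}=q_{i-\frac12,j+\frac12}$, $q_W=q_{i-\frac12,j}$, $q_{SW}=q_{i-\frac12,j-\frac12}$, $q_S=q_{i,j-\frac12}$, $q_{SE}=q_{i+\frac12,j-\frac12}$, $q_E=q_{i+\frac12,j}$). Then the resulting reconstruction is globally continuous, i.e. the reconstructions of adjacent cells agree on their common boundary and together define a continuous function on $\mathbb R^2$.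
   Context: The limited reconstruction $q_{\rm recon}$ on the reference cell $c=[-\frac{\Delta x}{2},\frac{\Delta x}{2}]\times[-\frac{\Delta y}{2},\frac{\Delta y}{2}]$ is defined from real point values $q_{NW},q_N,q_{NE},q_W,q_E,q_{SW},q_S,q_{SE}$ and average $\bar q$ as follows. Let $m$, $M$ be the minimum and maximum of the eight point values. If $m<\bar q<M$ does not hold, or if $m<\bar q<M$ and additionally $m\le q^{\rm pw}_{\rm recon}(x,y)\le M$ for all $(x,y)\in c$, then $q_{\rm recon}:=q^{\rm pw}_{\rm recon}$; otherwise $q_{\rm recon}:=q^{\rm plateau}_{\rm recon}$, with the two reconstructions defined below. **Locations.** The N-, S-, W-, E-edges of $c$ are the sides $y=\frac{\Delta y}2$, $y=-\frac{\Delta y}2$, $x=-\frac{\Delta x}2$, $x=\frac{\Delta x}2$. The values $q_N,q_S,q_W,q_E$ are located at the midpoints of these edges and $q_{NW},q_{NE},q_{SW},q_{SE}$ at the corners, e.g. $q_{NW}$ at $(-\frac{\Delta x}2,\frac{\Delta y}2)$, $q_{SE}$ at $(\frac{\Delta x}2,-\frac{\Delta y}2)$. Write $X=x/\Delta x$, $Y=y/\Delta y$. **Edge types.** For an edge with end values $\alpha,\gamma$ and midpoint value $\beta$, the edge has type "hat" if either (1) $\alpha\neq\gamma$ and neither $\alpha<\beta<\gamma$ nor $\alpha>\beta>\gamma$, or (2) $\alpha<\beta<\gamma$ or $\alpha>\beta>\gamma$, and $|\beta-\frac{\alpha+\gamma}{2}|>\frac{|\gamma-\alpha|}{4}$. Otherwise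 it has type "par" (parabolic). Denote the types of the four edges by $\tau_N,\tau_S,\tau_W,\tau_E$. **The function $\mathcal W$.** For types $s,n,w\in\{\text{par},\text{hat}\}$ and $a,b,e,r\in\mathbb R$ define $\mathcal W_{s,n,w}(a,b,e;X,Y;r)$ for $X,Y\in[-\frac12,\frac12]$ as $$C-bX-2(2C-b)X^2+(a_4X+a_5X^2)Y+(-4C+a_7X+a_8X^2)Y^2,$$ with $(a_4,a_5,a_7,a_8)$ and $C$ as follows. If $w=$ par: - $s=n=$ par: $(-(e-a),\,2(e-a),\,-2(e+a-2b),\,4(4C+e+a-2b))$; $C=\frac1{16}(36r-e-a-4b)$. - $s=n=$ hat: for $X<0$: $(-2(e-a),\,0,\,-4(e+a-b),\,8(2C-b))$; for $X\ge0$: $(0,\,0,\,4b,\,8(2C-b))$; $C=\frac1{32}(72r-3e-3a-8b)$. - $s=$ par, $n=$ hat: for $X<0$: $(-(2e-a),\,-2a,\,-2(2e+a-2b),\,4(4C+a-2b))$; for $X\ge0$: $(a,\,-2a,\,-2(a-2b),\,4(4C+a-2b))$; $C=\frac1{32}(72r-3e-2a-8b)$. - $s=$ hat, $n=$ par: for $X<0$: $(-(e-2a),\,2e,\,-2(e+2a-2b),\,4(4C+e-2b))$; for $X\ge0$: $(-e,\,2e,\,-2(e-2b),\,4(4C+e-2b))$; $C=\frac1{32}(72r-2e-3a-8b)$. If $w=$ hat: - for $Y\ge0$, $n=$ par: $(-2(e-b),\,4(e-b),\,0,\,16C)$. - for $Y\ge0$, $n=$ hat: if $X<0$: $(-(3e-2b),\,2(e-2b),\,-2e,\,4(4C-e))$;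 if $X\ge0$: $(a,\,-2a,\,-2(a-2b),\,4(4C+a-2b))$. - for $Y<0$, $s=$ par: $(2(a-b),\,-4(a-b),\,0,\,16C)$. - for $Y<0$, $s=$ hat: if $X<0$: $(3a-2b,\,-2(a-2b),\,-2a,\,4(4C-a))$; if $X\ge0$: $(-e,\,2e,\,-2(e-2b),\,4(4C+e-2b))$. - $C$ is the solution of $r=\frac{4C}{9}+I_n+I_s$, where $I_n=\frac{e+b}{24}$ if $n=$ par, $I_n=\frac{35e+a+22b}{576}$ if $n=$ hat, $I_s=\frac{a+b}{24}$ if $s=$ par, $I_s=\frac{e+35a+22b}{576}$ if $s=$ hat. **Piecewise-biparabolic reconstruction.** With $\bar Q=\frac18(q_{SW}+q_W+q_{NW}+q_N+q_{NE}+q_E+q_{SE}+q_S)$ and $r=\frac{\bar q-\bar Q}{4}$, $$\begin{aligned}q^{\rm pw}_{\rm recon}(x,y)=\bar Q&+\mathcal W_{\tau_S,\tau_N,\tau_W}\big(\tfrac{q_{SW}-\bar Q}2,q_W-\bar Q,\tfrac{q_{NW}-\bar Q}2;X,Y;r\big)\\&+\mathcal W_{\tau_E,\tau_W,\tau_S}\big(\tfrac{q_{SE}-\bar Q}2,q_S-\bar Q,\tfrac{q_{SW}-\bar Q}2;Y,-X;r\big)\\&+\mathcal W_{\tau_W,\tau_E,\tau_N}\big(\tfrac{q_{NW}-\bar Q}2,q_N-\bar Q,\tfrac{q_{NE}-\bar Q}2;-Y,X;r\big)\\&+\mathcal W_{\tau_N,\tau_S,\tau_E}\big(\tfrac{q_{NE}-\bar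 Q}2,q_E-\bar Q,\tfrac{q_{SE}-\bar Q}2;-X,-Y;r\big).\end{aligned}$$ **Plateau reconstruction** (used only when $m<\bar q<M$). For $\eta\in(0,\frac12)$, $p\in\mathbb R$, let $D_\eta=\{(X,Y):-\frac12\le X\le-\frac12+\eta,\ X\le Y\le -X\}$ and define on $D_\eta$: - $\mathcal T_{\rm par}(a,b,e;X,Y)=p\,\frac{1+2X}{2\eta}+(2\eta-1-2X)\Big(\frac{b}{2\eta}-\frac{(e-a)Y}{4\eta X}+\frac{(e+a-2b)Y^2}{4\eta X^2}\Big)$; - $\mathcal T_{\rm hat}(a,b,e;X,Y)=b-\frac{(e-b)Y}{X}+\frac{X+1/2}{\eta}\Big(p-b+\frac{(e-b)Y}{X}\Big)$ for $Y\ge0$, and $=b+\frac{(a-b)Y}{X}+\frac{X+1/2}{\eta}\Big(p-b-\frac{(a-b)Y}{X}\Big)$ for $Y<0$. Then, with $p=q_p$, - $q^{\rm plateau}_{\rm recon}(x,y)=q_p$ if $|X|\le\frac12-\eta$ and $|Y|\le\frac12-\eta$ (the plateau); - $=\mathcal T_{\tau_W}(q_{SW},q_W,q_{NW};X,Y)$ if $(X,Y)\in D_\eta$ (W-trapeze); - $=\mathcal T_{\tau_S}(q_{SE},q_S,q_{SW};Y,-X)$ if $(Y,-X)\in D_\eta$ (S-trapeze); - $=\mathcal T_{\tau_N}(q_{NW},q_N,q_{NE};-Y,X)$ if $(-Y,X)\in D_\eta$ (N-trapeze); - $=\mathcal T_{\tau_E}(q_{NE},q_E,q_{SE};-X,-Y)$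 if $(-X,-Y)\in D_\eta$ (E-trapeze). (On overlaps of these regions the definitions agree.) **Parameters $\eta,q_p$.** For an edge with end values $\alpha,\gamma$ and midpoint value $\beta$ let its mean be $\frac{\alpha+4\beta+\gamma}{6}$ if it has type par and $\frac{\alpha+2\beta+\gamma}{4}$ if it has type hat, and let $\Sigma$ be the sum of the four edge means. For given $\eta$, $q_p$ is determined by requiring the average of $q^{\rm plateau}_{\rm recon}$ over $c$ to be $\bar q$, which gives $q_p(\eta)=\frac{6\bar q-\eta(3-2\eta)\Sigma}{6-12\eta+8\eta^2}$. The parameter $\eta$ is half of the smallest real positive solution of $q_p(\eta)=m$ or $q_p(\eta)=M$ (both quadratic equations in $\eta$); if there is no real positive solution, $\eta=\frac14$. Then $q_p=q_p(\eta)$. *)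

theory Defs
  imports "HOL-Analysis.Analysis"
begin

text \<open>
  A function \<open>q :: loc \<Rightarrow> real\<close> collects the eight point values on the boundary of a cell:
  the compass directions stand for the corners and the edge midpoints.
\<close>

datatype loc = NW | N | NE | W | E | SW | S | SE

datatype edge_type = Par | Hat

definition edge_type_of :: "real \<Rightarrow> real \<Rightarrow> real \<Rightarrow> edge_type" where
  "edge_type_of \<alpha> \<beta> \<gamma> =
     (if (\<alpha> \<noteq> \<gamma> \<and> \<not> (\<alpha> < \<beta> \<and> \<beta> < \<gamma>) \<and> \<not> (\<alpha> > \<beta> \<and> \<beta> > \<gamma>)) \<or>
         (((\<alpha> < \<beta> \<and> \<beta> < \<gamma>) \<or> (\<alpha> > \<beta> \<and> \<beta> > \<gamma>)) \<and> \<bar>\<beta> - (\<alpha> + \<gamma>) / 2\<bar> > \<bar>\<gamma> - \<alpha>\<bar> / 4)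
      then Hat else Par)"

definition \<tau>N :: "(loc \<Rightarrow> real) \<Rightarrow> edge_type" where
  "\<tau>N q = edge_type_of (q NW) (q N) (q NE)"

definition \<tau>S :: "(loc \<Rightarrow> real) \<Rightarrow> edge_type" where
  "\<tau>S q = edge_type_of (q SW) (q S) (q SE)"

definition \<tau>W :: "(loc \<Rightarrow> real) \<Rightarrow> edge_type" where
  "\<tau>W q = edge_type_of (q SW) (q W) (q NW)"

definition \<tau>E :: "(loc \<Rightarrow> real) \<Rightarrow> edge_type" where
  "\<tau>E q = edge_type_of (q SE) (q E) (q NE)"


section \<open>The piecewise-biparabolic reconstruction\<close>

definition I_n :: "edge_type \<Rightarrow> real \<Rightarrow> real \<Rightarrow> real \<Rightarrow> real" where
  "I_n n a b e = (case n of Par \<Rightarrow> (e + b) / 24 | Hat \<Rightarrow> (35 * e + a + 22 * b) / 576)"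

definition I_s :: "edge_type \<Rightarrow> real \<Rightarrow> real \<Rightarrow> real \<Rightarrow> real" where
  "I_s s a b e = (case s of Par \<Rightarrow> (a + b) / 24 | Hat \<Rightarrow> (e + 35 * a + 22 * b) / 576)"

text \<open>The three edge types are always given in the order \<open>s\<close>, \<open>n\<close>, \<open>w\<close>.\<close>

fun \<W>_C :: "edge_type \<Rightarrow> edge_type \<Rightarrow> edge_type \<Rightarrow> real \<Rightarrow> real \<Rightarrow> real \<Rightarrow> real \<Rightarrow> real" where
  "\<W>_C Par Par Par a b e r = (36 * r - e - a - 4 * b) / 16"
| "\<W>_C Hat Hat Par a b e r = (72 * r - 3 * e - 3 * a - 8 * b) / 32"
| "\<W>_C Par Hat Par a b e r = (72 * r - 3 * e - 2 * a - 8 * b) / 32"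
| "\<W>_C Hat Par Par a b e r = (72 * r - 2 * e - 3 * a - 8 * b) / 32"
| "\<W>_C s n Hat a b e r = (THE C. r = 4 * C / 9 + I_n n a b e + I_s s a b e)"

text \<open>The coefficients \<open>(a\<^sub>4, a\<^sub>5, a\<^sub>7, a\<^sub>8)\<close>.\<close>

fun \<W>_coeffs :: "edge_type \<Rightarrow> edge_type \<Rightarrow> edge_type \<Rightarrow> real \<Rightarrow> real \<Rightarrow> real \<Rightarrow> real \<Rightarrow>
    real \<Rightarrow> real \<Rightarrow> real \<times> real \<times> real \<times> real" where
  "\<W>_coeffs Par Par Par a b e C X Y =
     (- (e - a), 2 * (e - a), - 2 * (e + a - 2 * b), 4 * (4 * C + e + a - 2 * b))"
| "\<W>_coeffs Hat Hat Par a b e C X Y =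
     (if X < 0 then (- 2 * (e - a), 0, - 4 * (e + a - b), 8 * (2 * C - b))
      else (0, 0, 4 * b, 8 * (2 * C - b)))"
| "\<W>_coeffs Par Hat Par a b e C X Y =
     (if X < 0 then (- (2 * e - a), - 2 * a, - 2 * (2 * e + a - 2 * b), 4 * (4 * C + a - 2 * b))
      else (a, - 2 * a, - 2 * (a - 2 * b), 4 * (4 * C + a - 2 * b)))"
| "\<W>_coeffs Hat Par Par a b e C X Y =
     (if X < 0 then (- (e - 2 * a), 2 * e, - 2 * (e + 2 * a - 2 * b), 4 * (4 * C + e - 2 * b))
      else (- e, 2 * e, - 2 * (e - 2 * b), 4 * (4 * C + e - 2 * b)))"
| "\<W>_coeffs s n Hat a b e C X Y =
     (if Y \<ge> 0 then
        (case n of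
           Par \<Rightarrow> (- 2 * (e - b), 4 * (e - b), 0, 16 * C)
         | Hat \<Rightarrow>
             (if X < 0 then (- (3 * e - 2 * b), 2 * (e - 2 * b), - 2 * e, 4 * (4 * C - e))
              else (a, - 2 * a, - 2 * (a - 2 * b), 4 * (4 * C + a - 2 * b))))
      else
        (case s of
           Par \<Rightarrow> (2 * (a - b), - 4 * (a - b), 0, 16 * C)
         | Hat \<Rightarrow>
             (if X < 0 then (3 * a - 2 * b, - 2 * (a - 2 * b), - 2 * a, 4 * (4 * C - a))
              else (- e, 2 * e, - 2 * (e - 2 * b), 4 * (4 * C + e - 2 * b)))))"

definition \<W> :: "edge_type \<Rightarrow> edge_type \<Rightarrow> edge_type \<Rightarrow> real \<Rightarrow> real \<Rightarrow> real \<Rightarrow>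
    real \<Rightarrow> real \<Rightarrow> real \<Rightarrow> real" where
  "\<W> s n w a b e X Y r =
     (let C = \<W>_C s n w a b e r;
          (a4, a5, a7, a8) = \<W>_coeffs s n w a b e C X Y
      in C - b * X - 2 * (2 * C - b) * X\<^sup>2 + (a4 * X + a5 * X\<^sup>2) * Y
           + (- 4 * C + a7 * X + a8 * X\<^sup>2) * Y\<^sup>2)"

definition Qbar :: "(loc \<Rightarrow> real) \<Rightarrow> real" where
  "Qbar q = (q SW + q W + q NW + q N + q NE + q E + q SE + q S) / 8"

definition q_pw :: "real \<Rightarrow> real \<Rightarrow> real \<Rightarrow> (loc \<Rightarrow> real) \<Rightarrow> real \<Rightarrow> real \<Rightarrow> real" where
  "q_pw \<Delta>x \<Delta>y qbar q x y =
     (let X = x / \<Delta>x; Y = y / \<Delta>y; Q = Qbar q; r = (qbar - Q) / 4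
      in Q
         + \<W> (\<tau>S q) (\<tau>N q) (\<tau>W q) ((q SW - Q) / 2) (q W - Q) ((q NW - Q) / 2) X Y r
         + \<W> (\<tau>E q) (\<tau>W q) (\<tau>S q) ((q SE - Q) / 2) (q S - Q) ((q SW - Q) / 2) Y (- X) r
         + \<W> (\<tau>W q) (\<tau>E q) (\<tau>N q) ((q NW - Q) / 2) (q N - Q) ((q NE - Q) / 2) (- Y) X r
         + \<W> (\<tau>N q) (\<tau>S q) (\<tau>E q) ((q NE - Q) / 2) (q E - Q) ((q SE - Q) / 2) (- X) (- Y) r)"


section \<open>The plateau reconstruction\<close>

definition min_val :: "(loc \<Rightarrow> real) \<Rightarrow> real" where
  "min_val q = Min {q NW, q N, q NE, q W, q E, q SW, q S, q SE}"

definition max_val :: "(loc \<Rightarrow> real) \<Rightarrow> real" where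
  "max_val q = Max {q NW, q N, q NE, q W, q E, q SW, q S, q SE}"

definition edge_mean :: "real \<Rightarrow> real \<Rightarrow> real \<Rightarrow> real" where
  "edge_mean \<alpha> \<beta> \<gamma> =
     (case edge_type_of \<alpha> \<beta> \<gamma> of
        Par \<Rightarrow> (\<alpha> + 4 * \<beta> + \<gamma>) / 6
      | Hat \<Rightarrow> (\<alpha> + 2 * \<beta> + \<gamma>) / 4)"

definition edge_mean_sum :: "(loc \<Rightarrow> real) \<Rightarrow> real" where
  "edge_mean_sum q =
     edge_mean (q NW) (q N) (q NE) + edge_mean (q SW) (q S) (q SE)
     + edge_mean (q SW) (q W) (q NW) + edge_mean (q SE) (q E) (q NE)"

text \<open>
  The plateau value for which the plateau reconstruction with parameter \<open>\<eta>\<close> has average \<open>qbar\<close>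
  over the cell; the denominator is at least \<open>3/2\<close> for every real \<open>\<eta>\<close>.
\<close>

definition plateau_val :: "real \<Rightarrow> (loc \<Rightarrow> real) \<Rightarrow> real \<Rightarrow> real" where
  "plateau_val qbar q \<eta> =
     (6 * qbar - \<eta> * (3 - 2 * \<eta>) * edge_mean_sum q) / (6 - 12 * \<eta> + 8 * \<eta>\<^sup>2)"

text \<open>
  For \<open>min_val q < qbar < max_val q\<close>, which is the only case in which the plateau reconstruction
  is used, there are only finitely many solutions, so that \<open>LEAST\<close> is meaningful.
\<close>

definition plateau_\<eta> :: "real \<Rightarrow> (loc \<Rightarrow> real) \<Rightarrow> real" where
  "plateau_\<eta> qbar q =
     (let sol = (\<lambda>t. t > 0 \<and> (plateau_val qbar q t = min_val q \<or> plateau_val qbar q t = max_val q))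
      in if \<exists>t. sol t then (LEAST t. sol t) / 2 else 1 / 4)"

definition trapeze :: "real \<Rightarrow> (real \<times> real) set" where
  "trapeze \<eta> = {(X, Y). - 1 / 2 \<le> X \<and> X \<le> - 1 / 2 + \<eta> \<and> X \<le> Y \<and> Y \<le> - X}"

fun \<T> :: "edge_type \<Rightarrow> real \<Rightarrow> real \<Rightarrow> real \<Rightarrow> real \<Rightarrow> real \<Rightarrow> real \<Rightarrow> real \<Rightarrow> real" where
  "\<T> Par \<eta> p a b e X Y =
     p * ((1 + 2 * X) / (2 * \<eta>))
     + (2 * \<eta> - 1 - 2 * X) *
       (b / (2 * \<eta>) - (e - a) * Y / (4 * \<eta> * X) + (e + a - 2 * b) * Y\<^sup>2 / (4 * \<eta> * X\<^sup>2))"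
| "\<T> Hat \<eta> p a b e X Y =
     (if Y \<ge> 0 then
        b - (e - b) * Y / X + (X + 1 / 2) / \<eta> * (p - b + (e - b) * Y / X)
      else
        b + (a - b) * Y / X + (X + 1 / 2) / \<eta> * (p - b - (a - b) * Y / X))"

text \<open>
  The plateau and the four trapezes cover the cell and overlap only along their boundaries, where
  the corresponding formulas agree; hence the order of the case distinction is immaterial.
\<close>

definition q_plateau :: "real \<Rightarrow> real \<Rightarrow> real \<Rightarrow> (loc \<Rightarrow> real) \<Rightarrow> real \<Rightarrow> real \<Rightarrow> real" where
  "q_plateau \<Delta>x \<Delta>y qbar q x y =
     (let X = x / \<Delta>x; Y = y / \<Delta>y; \<eta> = plateau_\<eta> qbar q; p = plateau_val qbar q \<eta>
      in if \<bar>X\<bar> \<le> 1 / 2 - \<eta> \<and> \<bar>Y\<bar> \<le> 1 / 2 - \<eta> then p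
         else if (X, Y) \<in> trapeze \<eta> then \<T> (\<tau>W q) \<eta> p (q SW) (q W) (q NW) X Y
         else if (Y, - X) \<in> trapeze \<eta> then \<T> (\<tau>S q) \<eta> p (q SE) (q S) (q SW) Y (- X)
         else if (- Y, X) \<in> trapeze \<eta> then \<T> (\<tau>N q) \<eta> p (q NW) (q N) (q NE) (- Y) X
         else if (- X, - Y) \<in> trapeze \<eta> then \<T> (\<tau>E q) \<eta> p (q NE) (q E) (q SE) (- X) (- Y)
         else undefined)"


section \<open>The limited reconstruction\<close>

definition ref_cell :: "real \<Rightarrow> real \<Rightarrow> (real \<times> real) set" where
  "ref_cell \<Delta>x \<Delta>y = {- \<Delta>x / 2..\<Delta>x / 2} \<times> {- \<Delta>y / 2..\<Delta>y / 2}"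

definition q_recon :: "real \<Rightarrow> real \<Rightarrow> real \<Rightarrow> (loc \<Rightarrow> real) \<Rightarrow> real \<Rightarrow> real \<Rightarrow> real" where
  "q_recon \<Delta>x \<Delta>y qbar q x y =
     (let m = min_val q; M = max_val q
      in if \<not> (m < qbar \<and> qbar < M) \<or>
            (m < qbar \<and> qbar < M \<and>
             (\<forall>(u, v) \<in> ref_cell \<Delta>x \<Delta>y.
                m \<le> q_pw \<Delta>x \<Delta>y qbar q u v \<and> q_pw \<Delta>x \<Delta>y qbar q u v \<le> M))
         then q_pw \<Delta>x \<Delta>y qbar q x y
         else q_plateau \<Delta>x \<Delta>y qbar q x y)"


section \<open>The reconstruction on a Cartesian grid\<close>

text \<open>
  Here \<open>xc i\<close> and \<open>yc j\<close> are the coordinates of the cell centers.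
  Half-integer indices are encoded by rounding them down:
  \<open>qc i j\<close> is the corner value at \<open>(i + 1/2, j + 1/2)\<close>,
  \<open>qv i j\<close> is the value at \<open>(i + 1/2, j)\<close> (midpoint of a vertical edge), and
  \<open>qh i j\<close> is the value at \<open>(i, j + 1/2)\<close> (midpoint of a horizontal edge).
\<close>

definition grid_cell :: "real \<Rightarrow> real \<Rightarrow> (int \<Rightarrow> real) \<Rightarrow> (int \<Rightarrow> real) \<Rightarrow> int \<Rightarrow> int \<Rightarrow>
    (real \<times> real) set" where
  "grid_cell \<Delta>x \<Delta>y xc yc i j =
     {xc i - \<Delta>x / 2..xc i + \<Delta>x / 2} \<times> {yc j - \<Delta>y / 2..yc j + \<Delta>y / 2}"

definition cell_values :: "(int \<Rightarrow> int \<Rightarrow> real) \<Rightarrow> (int \<Rightarrow> int \<Rightarrow> real) \<Rightarrow> (int \<Rightarrow> int \<Rightarrow> real) \<Rightarrow>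
    int \<Rightarrow> int \<Rightarrow> loc \<Rightarrow> real" where
  "cell_values qc qv qh i j l =
     (case l of
        NE \<Rightarrow> qc i j | N \<Rightarrow> qh i j | NW \<Rightarrow> qc (i - 1) j | W \<Rightarrow> qv (i - 1) j
      | SW \<Rightarrow> qc (i - 1) (j - 1) | S \<Rightarrow> qh i (j - 1) | SE \<Rightarrow> qc i (j - 1) | E \<Rightarrow> qv i j)"

definition cell_recon :: "real \<Rightarrow> real \<Rightarrow> (int \<Rightarrow> real) \<Rightarrow> (int \<Rightarrow> real) \<Rightarrow> (int \<Rightarrow> int \<Rightarrow> real) \<Rightarrow>
    (int \<Rightarrow> int \<Rightarrow> real) \<Rightarrow> (int \<Rightarrow> int \<Rightarrow> real) \<Rightarrow> (int \<Rightarrow> int \<Rightarrow> real) \<Rightarrow>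
    int \<Rightarrow> int \<Rightarrow> real \<times> real \<Rightarrow> real" where
  "cell_recon \<Delta>x \<Delta>y xc yc qbar qc qv qh i j =
     (\<lambda>(x, y). q_recon \<Delta>x \<Delta>y (qbar i j) (cell_values qc qv qh i j) (x - xc i) (y - yc j))"

end

theory Submission
  imports Defs
begin

text \<open>
  The idea is that the reconstruction in a cell, whichever of the two kinds it is, restricts on each
  edge of the cell to a function that depends only on the three point values on that edge: the
  parabola through them if the edge is of type \<open>Par\<close>, the broken line through them if it is of type
  \<open>Hat\<close> (\<open>edge_profile\<close>). Neither the cell average nor the other five point values survive. Adjacent
  cells share the three values, and the edge type is a function of these values, so the two traces
  on a common edge are the same. What remains is that the reconstruction is continuous inside each
  cell; the pieces can then be glued, because the closed cells form a locally finite cover of the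
  plane.

  For the piecewise-biparabolic reconstruction, a single function \<open>\<W>\<close> takes the profile of its
  own edge on that edge, vanishes on the opposite edge, and has on each of the two neighbouring edges the
  profile with only the common corner value kept (\<open>\<W>_left\<close>, \<open>\<W>_right\<close>, \<open>\<W>_top\<close>, \<open>\<W>_bottom\<close>).
  The constant \<open>C\<close>, which carries the cell average, cancels on the whole boundary. Profiles are
  linear in the values, and each corner value enters with weight one half through each of the two
  adjacent \<open>\<W>\<close>, so the four functions add up to the right trace. Continuity is automatic: the
  coefficients change only across the axes \<open>X = 0\<close> and \<open>Y = 0\<close>, and the monomials to which they
  belong all contain the factor \<open>XY\<close>.

  For the plateau reconstruction, each trapeze function is the convex combination, along rays from the
  centre of the cell, of the edge profile and the plateau value \<open>p\<close> (\<open>\<T>_blend\<close>). Hence it has the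
  right trace, it equals \<open>p\<close> on the plateau boundary, and on a diagonal it interpolates between \<open>p\<close>
  and the corner value, which two neighbouring trapezes have in common. None of this depends on \<open>p\<close>,
  but it does need \<open>0 < \<eta> < 1/2\<close>. This holds when \<open>qbar\<close> lies strictly between the minimum and
  the maximum of the point values, because \<open>plateau_val\<close>, as a function of \<open>\<eta>\<close>, is
  symmetric about \<open>3/4\<close>, and outside \<open>(0, 3/2)\<close> it stays strictly between these extremes;
  so the smallest positive solution, if there is one, is at most \<open>3/4\<close>, and
  \<open>\<eta> \<le> 3/8\<close> (\<open>plateau_\<eta>_bounds\<close>).
\<close>

section \<open>Traces on an edge\<close>

text \<open>
  The parabola or the broken line that takes the values \<open>a\<close>, \<open>b\<close>, \<open>e\<close> at \<open>-1/2\<close>, \<open>0\<close>, \<open>1/2\<close>.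
\<close>
definition edge_profile :: "edge_type \<Rightarrow> real \<Rightarrow> real \<Rightarrow> real \<Rightarrow> real \<Rightarrow> real" where
  "edge_profile \<tau> a b e v =
     (case \<tau> of
        Par \<Rightarrow> b + (e - a) * v + 2 * (e + a - 2 * b) * v\<^sup>2
      | Hat \<Rightarrow> (if v \<ge> 0 then b + 2 * (e - b) * v else b - 2 * (a - b) * v))"

lemma edge_profile_start [simp]: "edge_profile \<tau> a b e (- 1 / 2) = a"
  and edge_profile_end [simp]: "edge_profile \<tau> a b e (1 / 2) = e"
  by (cases \<tau>; simp add: edge_profile_def power2_eq_square field_simps)+

lemma edge_profile_reverse: "edge_profile \<tau> e b a (- v) = edge_profile \<tau> a b e v"
  by (cases \<tau>) (auto simp: edge_profile_def algebra_simps)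

lemma continuous_on_if_less_zero:
  fixes h :: "'a::topological_space \<Rightarrow> real" and f g :: "'a \<Rightarrow> 'b::topological_space"
  assumes "continuous_on A f" "continuous_on A g" "continuous_on A h"
    and "\<And>z. z \<in> A \<Longrightarrow> h z = 0 \<Longrightarrow> f z = g z"
  shows "continuous_on A (\<lambda>z. if h z < 0 then f z else g z)"
proof -
  have "continuous_on A (\<lambda>z. if - h z \<le> 0 then g z else f z)"
    using assms
    by (intro continuous_on_cases_le continuous_on_minus) (auto elim: continuous_on_subset)
  moreover have "(\<lambda>z. if - h z \<le> 0 then g z else f z) = (\<lambda>z. if h z < 0 then f z else g z)"
    by (auto simp: fun_eq_iff)
  ultimately show ?thesis by (simp only:)
qed

lemma continuous_edge_profile: "continuous_on UNIV (edge_profile \<tau> a b e)"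
proof (cases \<tau>)
  case Par
  then show ?thesis by (auto simp: edge_profile_def [abs_def] intro!: continuous_intros)
next
  case Hat
  have "edge_profile Hat a b e = (\<lambda>v. if v < 0 then b - 2 * (a - b) * v else b + 2 * (e - b) * v)"
    by (auto simp: edge_profile_def fun_eq_iff)
  moreover have "continuous_on UNIV (\<lambda>v. if v < 0 then b - 2 * (a - b) * v else b + 2 * (e - b) * v)"
    by (intro continuous_on_if_less_zero continuous_intros) auto
  ultimately show ?thesis using Hat by simp
qed

section \<open>The piecewise-biparabolic reconstruction\<close>

text \<open>
  The four boundary traces of \<open>\<W>\<close>. On each quadrant the terms with \<open>C\<close> add up to
  \<open>C (1 - 4X\<^sup>2) (1 - 4Y\<^sup>2)\<close>, which vanishes on the boundary; so \<open>C\<close> is kept abstract in the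
  calculations.
\<close>
lemma \<W>_left: "\<W> s n w a b e (- 1 / 2) Y r = edge_profile w a b e Y"
  by (cases s; cases n; cases w)
    (auto simp: \<W>_def Let_def edge_profile_def power2_eq_square field_simps simp del: \<W>_C.simps)

lemma \<W>_right: "\<W> s n w a b e (1 / 2) Y r = 0"
  by (cases s; cases n; cases w)
    (auto simp: \<W>_def Let_def edge_profile_def power2_eq_square field_simps simp del: \<W>_C.simps)

lemma \<W>_top: "\<W> s n w a b e X (1 / 2) r = edge_profile n e 0 0 X"
  by (cases s; cases n; cases w)
    (auto simp: \<W>_def Let_def edge_profile_def power2_eq_square field_simps simp del: \<W>_C.simps)

lemma \<W>_bottom: "\<W> s n w a b e X (- 1 / 2) r = edge_profile s a 0 0 X"
  by (cases s; cases n; cases w)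
    (auto simp: \<W>_def Let_def edge_profile_def power2_eq_square field_simps simp del: \<W>_C.simps)

text \<open>
  On each quadrant \<open>\<W>\<close> is a polynomial, whose coefficients \<open>k = (a\<^sub>4, a\<^sub>5, a\<^sub>7, a\<^sub>8)\<close> belong to
  monomials that contain the factor \<open>XY\<close>. So the choice of \<open>k\<close> is immaterial on the axes.
\<close>
definition quadrant_poly :: "real \<Rightarrow> real \<Rightarrow> real \<times> real \<times> real \<times> real \<Rightarrow> real \<times> real \<Rightarrow> real" where
  "quadrant_poly C b k = (\<lambda>(X, Y). case k of (a4, a5, a7, a8) \<Rightarrow>
     C - b * X - 2 * (2 * C - b) * X\<^sup>2 + (a4 * X + a5 * X\<^sup>2) * Y
       + (- 4 * C + a7 * X + a8 * X\<^sup>2) * Y\<^sup>2)"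

lemma continuous_quadrant_poly: "continuous_on UNIV (quadrant_poly C b k)"
  unfolding quadrant_poly_def by (cases k) (auto simp: case_prod_beta intro!: continuous_intros)

lemma quadrant_poly_on_axes:
  assumes "fst z = 0 \<or> snd z = 0"
  shows "quadrant_poly C b k z = quadrant_poly C b k' z"
  using assms by (cases z; cases k; cases k') (auto simp: quadrant_poly_def)

text \<open>
  The point \<open>(X, Y)\<close> enters the coefficients only through its quadrant, for which \<open>0\<close> and \<open>-1\<close>
  serve as representatives of the nonnegative and the negative numbers.
\<close>
lemma \<W>_coeffs_quadrant:
  "\<W>_coeffs s n w a b e C X Y =
     \<W>_coeffs s n w a b e C (if X < 0 then - 1 else 0) (if Y < 0 then - 1 else 0)"
  by (cases s; cases n; cases w) auto

lemma continuous_\<W>: "continuous_on UNIV (\<lambda>z. \<W> s n w a b e (fst z) (snd z) r)"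
proof -
  define C where "C = \<W>_C s n w a b e r"
  define G where "G X Y = quadrant_poly C b (\<W>_coeffs s n w a b e C X Y)" for X Y
  have "(\<lambda>z. \<W> s n w a b e (fst z) (snd z) r) =
    (\<lambda>z. if snd z < 0 then (if fst z < 0 then G (- 1) (- 1) z else G 0 (- 1) z)
         else (if fst z < 0 then G (- 1) 0 z else G 0 0 z))" (is "_ = ?g")
  proof
    fix z :: "real \<times> real"
    have "\<W> s n w a b e (fst z) (snd z) r = G (fst z) (snd z) z"
      by (simp add: \<W>_def Let_def G_def C_def quadrant_poly_def case_prod_beta)
    also have "\<dots> = ?g z"
      unfolding G_def by (subst \<W>_coeffs_quadrant) auto
    finally show "\<W> s n w a b e (fst z) (snd z) r = ?g z" .
  qed
  moreover have "continuous_on UNIV ?g"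
    unfolding G_def
    by (intro continuous_on_if_less_zero continuous_quadrant_poly continuous_on_fst continuous_on_snd
        continuous_on_id) (auto intro: quadrant_poly_on_axes)
  ultimately show ?thesis by (simp only:)
qed

lemma continuous_on_\<W> [continuous_intros]:
  assumes "continuous_on A f" "continuous_on A g"
  shows "continuous_on A (\<lambda>z. \<W> s n w a b e (f z) (g z) r)"
  using continuous_on_compose2 [OF continuous_\<W> continuous_on_Pair [OF assms]] by simp

lemma q_pw_rescale: "q_pw \<Delta>x \<Delta>y qbar q x y = q_pw 1 1 qbar q (x / \<Delta>x) (y / \<Delta>y)"
  by (simp add: q_pw_def)

lemma continuous_q_pw: "continuous_on A (\<lambda>(x, y). q_pw 1 1 qbar q x y)"
  unfolding q_pw_def Let_def case_prod_beta by (auto intro!: continuous_intros)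

text \<open>
  The contributions to the trace on one edge: the edge's own \<open>\<W>\<close> sees the two corner values halved,
  and each of the two neighbouring edges supplies the missing half of one corner value. Since
  profiles are linear in the values and reproduce constants, the shift by \<open>Q\<close> disappears.
\<close>
lemma edge_profile_superpose:
  "Q + edge_profile \<tau> ((a - Q) / 2) (b - Q) ((e - Q) / 2) v
     + edge_profile \<tau> ((a - Q) / 2) 0 0 v + edge_profile \<tau> 0 0 ((e - Q) / 2) v
   = edge_profile \<tau> a b e v"
  by (cases \<tau>) (auto simp: edge_profile_def field_simps)

lemma q_pw_trace:
  "q_pw 1 1 qbar q (- 1 / 2) v = edge_profile (\<tau>W q) (q SW) (q W) (q NW) v"
  "q_pw 1 1 qbar q (1 / 2) v = edge_profile (\<tau>E q) (q SE) (q E) (q NE) v"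
  "q_pw 1 1 qbar q v (- 1 / 2) = edge_profile (\<tau>S q) (q SW) (q S) (q SE) v"
  "q_pw 1 1 qbar q v (1 / 2) = edge_profile (\<tau>N q) (q NW) (q N) (q NE) v"
proof -
  have m: "- (- 1 / 2) = (1 / 2 :: real)" "- (1 / 2) = (- 1 / 2 :: real)" by simp_all
  note simps = q_pw_def Let_def div_by_1 m \<W>_left \<W>_right \<W>_top \<W>_bottom
  note superpose = edge_profile_superpose [of "Qbar q" _ _ _ _ v]
  show "q_pw 1 1 qbar q (- 1 / 2) v = edge_profile (\<tau>W q) (q SW) (q W) (q NW) v"
    using superpose [of "\<tau>W q" "q SW" "q W" "q NW"]
    by (simp only: simps edge_profile_reverse)
  show "q_pw 1 1 qbar q (1 / 2) v = edge_profile (\<tau>E q) (q SE) (q E) (q NE) v"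
    using superpose [of "\<tau>E q" "q SE" "q E" "q NE"]
    by (simp only: simps edge_profile_reverse)
  show "q_pw 1 1 qbar q v (- 1 / 2) = edge_profile (\<tau>S q) (q SW) (q S) (q SE) v"
    using superpose [of "\<tau>S q" "q SW" "q S" "q SE"]
    by (simp only: simps edge_profile_reverse)
  show "q_pw 1 1 qbar q v (1 / 2) = edge_profile (\<tau>N q) (q NW) (q N) (q NE) v"
    using superpose [of "\<tau>N q" "q NW" "q N" "q NE"]
    by (simp only: simps edge_profile_reverse)
qed

section \<open>The width of the plateau frame\<close>

lemma min_val_le: "min_val q \<le> q l" and le_max_val: "q l \<le> max_val q"
  unfolding min_val_def max_val_def by (cases l; intro Min_le Max_ge; simp)+

lemma edge_mean_lower: "m \<le> \<alpha> \<Longrightarrow> m \<le> \<beta> \<Longrightarrow> m \<le> \<gamma> \<Longrightarrow> m \<le> edge_mean \<alpha> \<beta> \<gamma>"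
  and edge_mean_upper: "\<alpha> \<le> M \<Longrightarrow> \<beta> \<le> M \<Longrightarrow> \<gamma> \<le> M \<Longrightarrow> edge_mean \<alpha> \<beta> \<gamma> \<le> M"
  by (auto simp: edge_mean_def split: edge_type.split)

lemma edge_mean_sum_bounds:
  "min_val q \<le> edge_mean_sum q / 4" "edge_mean_sum q / 4 \<le> max_val q"
proof -
  have *: "min_val q \<le> edge_mean (q k) (q l) (q l')" "edge_mean (q k) (q l) (q l') \<le> max_val q"
    for k l l'
    by (intro edge_mean_lower edge_mean_upper min_val_le le_max_val)+
  show "min_val q \<le> edge_mean_sum q / 4" "edge_mean_sum q / 4 \<le> max_val q"
    unfolding edge_mean_sum_def
    using *[of NW N NE] *[of SW S SE] *[of SW W NW] *[of SE E NE] by auto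
qed

abbreviation plateau_denom :: "real \<Rightarrow> real" where
  "plateau_denom t \<equiv> 6 - 12 * t + 8 * t\<^sup>2"

lemma plateau_denom_square: "plateau_denom t = 8 * (t - 3 / 4)\<^sup>2 + 3 / 2"
  by (simp add: power2_eq_square field_simps)

lemma plateau_denom_pos: "plateau_denom t > 0"
  unfolding plateau_denom_square by (simp add: add_nonneg_pos)

text \<open>
  Since \<open>4t (3 - 2t)\<close> is \<open>6\<close> minus the denominator, the plateau value deviates from the average
  \<open>\<mu>\<close> of the edge means exactly as \<open>qbar\<close> does, up to a factor that depends on \<open>t\<close> alone. Both the
  symmetry about \<open>3/4\<close> and the behaviour for large \<open>t\<close> can be read off from this form.
\<close>
lemma plateau_val_eq:
  fixes q qbar
  defines "\<mu> \<equiv> edge_mean_sum q / 4"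
  shows "plateau_val qbar q t = \<mu> + 6 * (qbar - \<mu>) / plateau_denom t"
  using plateau_denom_pos[of t] unfolding plateau_val_def \<mu>_def
  by (simp add: field_simps power2_eq_square)

lemma plateau_val_reflect: "plateau_val qbar q (3 / 2 - t) = plateau_val qbar q t"
proof -
  have "plateau_denom (3 / 2 - t) = plateau_denom t"
    by (simp add: power2_eq_square field_simps)
  then show ?thesis unfolding plateau_val_eq by simp
qed

text \<open>
  For \<open>t \<ge> 3/2\<close> the denominator is at least \<open>6\<close>, its value at \<open>0\<close>. The plateau value is then a
  convex combination of \<open>\<mu>\<close>, which lies in the closed range of the point values, and \<open>qbar\<close>, which
  lies in the open one and has positive weight.
\<close>
lemma plateau_val_inside:
  assumes "min_val q < qbar" "qbar < max_val q" "t \<ge> 3 / 2"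
  shows "min_val q < plateau_val qbar q t" "plateau_val qbar q t < max_val q"
proof -
  define \<mu> where "\<mu> = edge_mean_sum q / 4"
  define \<theta> where "\<theta> = 6 / plateau_denom t"
  have "(3 / 4)\<^sup>2 \<le> (t - 3 / 4)\<^sup>2" using assms by (intro power_mono) auto
  then have "plateau_denom t \<ge> 6"
    unfolding plateau_denom_square by (simp add: power2_eq_square)
  then have \<theta>: "0 < \<theta>" "\<theta> \<le> 1" using plateau_denom_pos[of t] by (auto simp: \<theta>_def)
  have val: "plateau_val qbar q t = (1 - \<theta>) * \<mu> + \<theta> * qbar"
  proof -
    have "6 * (qbar - \<mu>) / plateau_denom t = \<theta> * (qbar - \<mu>)" by (simp add: \<theta>_def)
    then show ?thesis unfolding plateau_val_eq \<mu>_def[symmetric] by (simp add: algebra_simps)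
  qed
  have \<mu>: "min_val q \<le> \<mu>" "\<mu> \<le> max_val q" unfolding \<mu>_def by (rule edge_mean_sum_bounds)+
  have "(1 - \<theta>) * min_val q \<le> (1 - \<theta>) * \<mu>" "\<theta> * min_val q < \<theta> * qbar"
    "(1 - \<theta>) * \<mu> \<le> (1 - \<theta>) * max_val q" "\<theta> * qbar < \<theta> * max_val q"
    using assms \<theta> \<mu> by (auto intro: mult_left_mono)
  then show "min_val q < plateau_val qbar q t" "plateau_val qbar q t < max_val q"
    unfolding val by (auto simp: algebra_simps)
qed

text \<open>
  This gives finiteness of the set of solutions, so that a smallest one exists. The value \<open>K\<close> has
  to be extremal: if \<open>qbar = \<mu>\<close>, then \<open>plateau_val\<close> is constant.
\<close>
lemma plateau_val_fibre:
  assumes "min_val q < qbar" "qbar < max_val q"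
    and "plateau_val qbar q t = K" "plateau_val qbar q u = K" "K = min_val q \<or> K = max_val q"
  shows "u = t \<or> u = 3 / 2 - t"
proof -
  define \<mu> where "\<mu> = edge_mean_sum q / 4"
  have eq: "6 * (qbar - \<mu>) = (K - \<mu>) * plateau_denom x" if "plateau_val qbar q x = K" for x
    using that plateau_denom_pos[of x] unfolding plateau_val_eq \<mu>_def[symmetric]
    by (auto simp: field_simps)
  have "K \<noteq> \<mu>"
  proof
    assume "K = \<mu>"
    with eq[OF assms(3)] have "qbar = K" by simp
    then show False using assms by auto
  qed
  moreover have "(K - \<mu>) * plateau_denom t = (K - \<mu>) * plateau_denom u"
    using eq[OF assms(3)] eq[OF assms(4)] by linarith
  ultimately have "(t - 3 / 4)\<^sup>2 = (u - 3 / 4)\<^sup>2"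
    unfolding plateau_denom_square by auto
  then show ?thesis unfolding power2_eq_iff by auto
qed

text \<open>
  If \<open>t\<close> is the smallest positive solution, then \<open>t < 3/2\<close>, so the reflected solution \<open>3/2 - t\<close> is
  positive as well. Minimality gives \<open>t \<le> 3/4\<close>, and \<open>\<eta>\<close> is half of \<open>t\<close>.
\<close>
lemma plateau_\<eta>_bounds:
  assumes "min_val q < qbar" "qbar < max_val q"
  shows "0 < plateau_\<eta> qbar q" "plateau_\<eta> qbar q < 1 / 2"
proof -
  define sol where "sol t \<longleftrightarrow>
    t > 0 \<and> (plateau_val qbar q t = min_val q \<or> plateau_val qbar q t = max_val q)" for t
  have \<eta>: "plateau_\<eta> qbar q = (if \<exists>t. sol t then (LEAST t. sol t) / 2 else 1 / 4)"
    unfolding plateau_\<eta>_def Let_def sol_def ..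
  have "0 < plateau_\<eta> qbar q \<and> plateau_\<eta> qbar q < 1 / 2"
  proof (cases "\<exists>t. sol t")
    case True
    have fibre: "finite {t. plateau_val qbar q t = K}" if K: "K = min_val q \<or> K = max_val q" for K
    proof (cases "\<exists>t. plateau_val qbar q t = K")
      case True
      then obtain t where "plateau_val qbar q t = K" by blast
      then have "{t. plateau_val qbar q t = K} \<subseteq> {t, 3 / 2 - t}"
        using plateau_val_fibre[OF assms _ _ K] by blast
      then show ?thesis by (rule finite_subset) simp
    qed auto
    have fin: "finite {t. sol t}"
      using finite_UnI [OF fibre [of "min_val q"] fibre [of "max_val q"]]
      by (rule finite_subset [rotated]) (auto simp: sol_def)
    define t where "t = (LEAST t. sol t)"
    have t: "t = Min {t. sol t}" unfolding t_def using fin True by (rule Least_Min)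
    have "sol t" using Min_in [OF fin] True t by auto
    then have "0 < t" by (simp add: sol_def)
    have "t < 3 / 2"
      using plateau_val_inside[OF assms, of t] \<open>sol t\<close> by (force simp: sol_def)
    with \<open>sol t\<close> have "sol (3 / 2 - t)" by (simp add: sol_def plateau_val_reflect)
    then have "t \<le> 3 / 2 - t" using Min_le [OF fin] t by simp
    then show ?thesis using True \<open>0 < t\<close> unfolding \<eta> t_def[symmetric] by simp
  qed (simp add: \<eta>)
  then show "0 < plateau_\<eta> qbar q" "plateau_\<eta> qbar q < 1 / 2" by auto
qed

section \<open>The plateau reconstruction\<close>

text \<open>
  The ray from the origin through \<open>(X, Y)\<close> meets the edge \<open>X = -1/2\<close> at height \<open>- Y / (2X)\<close>, and
  \<open>(X + 1/2) / \<eta>\<close> grows from \<open>0\<close> on that edge to \<open>1\<close> on the boundary of the plateau. In this form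
  both types of trapeze function are the same blend of edge profile and plateau value, and every
  property of \<open>\<T>\<close> below is one of the edge profile.
\<close>
lemma \<T>_blend:
  assumes "X < 0" "\<eta> \<noteq> 0"
  shows "\<T> \<tau> \<eta> p a b e X Y =
    (1 - (X + 1 / 2) / \<eta>) * edge_profile \<tau> a b e (- (Y / (2 * X))) + (X + 1 / 2) / \<eta> * p"
proof (cases \<tau>)
  case Par
  then show ?thesis using assms
    by (simp add: edge_profile_def divide_simps power2_eq_square) (simp add: algebra_simps)
next
  case Hat
  have "- (Y / (2 * X)) \<ge> 0 \<longleftrightarrow> Y \<ge> 0" using assms by (simp add: divide_simps)
  then show ?thesis using Hat assms
    by (auto simp add: edge_profile_def divide_simps) (simp_all add: algebra_simps)
qed

lemma \<T>_edge:
  assumes "\<eta> \<noteq> 0"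
  shows "\<T> \<tau> \<eta> p a b e (- 1 / 2) Y = edge_profile \<tau> a b e Y"
  using assms by (subst \<T>_blend) auto

lemma \<T>_inner:
  assumes "0 < \<eta>" "\<eta> < 1 / 2" "X = - 1 / 2 + \<eta>"
  shows "\<T> \<tau> \<eta> p a b e X Y = p"
  using assms by (subst \<T>_blend) auto

lemma \<T>_diagonal:
  assumes "X < 0" "\<eta> \<noteq> 0"
  shows "\<T> \<tau> \<eta> p a b e X X = (1 - (X + 1 / 2) / \<eta>) * a + (X + 1 / 2) / \<eta> * p"
    and "\<T> \<tau> \<eta> p a b e X (- X) = (1 - (X + 1 / 2) / \<eta>) * e + (X + 1 / 2) / \<eta> * p"
proof -
  have "- (X / (2 * X)) = - 1 / 2" "- (- X / (2 * X)) = 1 / 2" using assms by auto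
  then show "\<T> \<tau> \<eta> p a b e X X = (1 - (X + 1 / 2) / \<eta>) * a + (X + 1 / 2) / \<eta> * p"
    "\<T> \<tau> \<eta> p a b e X (- X) = (1 - (X + 1 / 2) / \<eta>) * e + (X + 1 / 2) / \<eta> * p"
    by (simp_all only: \<T>_blend [OF assms] edge_profile_start edge_profile_end)
qed

lemma continuous_on_\<T>:
  fixes f g :: "'a::topological_space \<Rightarrow> real"
  assumes "continuous_on A f" "continuous_on A g" "\<And>z. z \<in> A \<Longrightarrow> f z < 0" "\<eta> \<noteq> 0"
  shows "continuous_on A (\<lambda>z. \<T> \<tau> \<eta> p a b e (f z) (g z))"
proof -
  have "continuous_on A (\<lambda>z. - (g z / (2 * f z)))"
    using assms by (intro continuous_intros) (auto dest!: assms(3))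
  then have "continuous_on A (\<lambda>z. edge_profile \<tau> a b e (- (g z / (2 * f z))))"
    by (rule continuous_on_compose2 [OF continuous_edge_profile]) simp
  then have "continuous_on A (\<lambda>z. (1 - (f z + 1 / 2) / \<eta>) * edge_profile \<tau> a b e (- (g z / (2 * f z)))
      + (f z + 1 / 2) / \<eta> * p)"
    using assms by (auto intro!: continuous_intros)
  then show ?thesis
    by (rule continuous_on_eq) (simp add: \<T>_blend assms)
qed

lemma q_plateau_rescale: "q_plateau \<Delta>x \<Delta>y qbar q x y = q_plateau 1 1 qbar q (x / \<Delta>x) (y / \<Delta>y)"
  by (simp add: q_plateau_def)

text \<open>
  On the overlaps of the five regions the competing formulas agree, so each formula is valid on the
  whole of its closed region, whatever the order of the case distinction.
\<close>
lemma q_plateau_pieces: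
  fixes q qbar
  defines "\<eta> \<equiv> plateau_\<eta> qbar q"
  defines "p \<equiv> plateau_val qbar q \<eta>"
  assumes \<eta>: "0 < \<eta>" "\<eta> < 1 / 2"
  shows "\<bar>X\<bar> \<le> 1 / 2 - \<eta> \<Longrightarrow> \<bar>Y\<bar> \<le> 1 / 2 - \<eta> \<Longrightarrow> q_plateau 1 1 qbar q X Y = p"
    and "(X, Y) \<in> trapeze \<eta> \<Longrightarrow>
      q_plateau 1 1 qbar q X Y = \<T> (\<tau>W q) \<eta> p (q SW) (q W) (q NW) X Y"
    and "(Y, - X) \<in> trapeze \<eta> \<Longrightarrow>
      q_plateau 1 1 qbar q X Y = \<T> (\<tau>S q) \<eta> p (q SE) (q S) (q SW) Y (- X)"
    and "(- Y, X) \<in> trapeze \<eta> \<Longrightarrow>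
      q_plateau 1 1 qbar q X Y = \<T> (\<tau>N q) \<eta> p (q NW) (q N) (q NE) (- Y) X"
    and "(- X, - Y) \<in> trapeze \<eta> \<Longrightarrow>
      q_plateau 1 1 qbar q X Y = \<T> (\<tau>E q) \<eta> p (q NE) (q E) (q SE) (- X) (- Y)"
proof -
  have eq: "q_plateau 1 1 qbar q X Y =
     (if \<bar>X\<bar> \<le> 1 / 2 - \<eta> \<and> \<bar>Y\<bar> \<le> 1 / 2 - \<eta> then p
      else if (X, Y) \<in> trapeze \<eta> then \<T> (\<tau>W q) \<eta> p (q SW) (q W) (q NW) X Y
      else if (Y, - X) \<in> trapeze \<eta> then \<T> (\<tau>S q) \<eta> p (q SE) (q S) (q SW) Y (- X)
      else if (- Y, X) \<in> trapeze \<eta> then \<T> (\<tau>N q) \<eta> p (q NW) (q N) (q NE) (- Y) X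
      else if (- X, - Y) \<in> trapeze \<eta> then \<T> (\<tau>E q) \<eta> p (q NE) (q E) (q SE) (- X) (- Y)
      else undefined)"
    by (simp add: q_plateau_def Let_def \<eta>_def p_def)
  have inner: "\<T> \<tau> \<eta> p a b e x y = p"
    if "(x, y) \<in> trapeze \<eta>" "\<bar>x\<bar> \<le> 1 / 2 - \<eta>" for \<tau> a b e x y
    using that \<eta> by (intro \<T>_inner) (auto simp: trapeze_def)
  have neg: "x < 0" if "(x, y) \<in> trapeze \<eta>" for x y
    using that \<eta> by (auto simp: trapeze_def)
  \<comment> \<open>Two trapezes that are consecutive in the anticlockwise order share a diagonal.\<close>
  have diag: "\<T> \<tau> \<eta> p a b e x y = \<T> \<tau>' \<eta> p a' b' a y (- x)"
    if "(x, y) \<in> trapeze \<eta>" "(y, - x) \<in> trapeze \<eta>" for \<tau> \<tau>' a b e a' b' x y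
  proof -
    have "y = x" "x < 0" using that \<eta> by (auto simp: trapeze_def)
    then show ?thesis using \<eta> by (simp add: \<T>_diagonal)
  qed
  show "q_plateau 1 1 qbar q X Y = p" if "\<bar>X\<bar> \<le> 1 / 2 - \<eta>" "\<bar>Y\<bar> \<le> 1 / 2 - \<eta>"
    using that by (simp add: eq)
  show "q_plateau 1 1 qbar q X Y = \<T> (\<tau>W q) \<eta> p (q SW) (q W) (q NW) X Y"
    if "(X, Y) \<in> trapeze \<eta>"
    using that inner[OF that] by (simp add: eq)
  show "q_plateau 1 1 qbar q X Y = \<T> (\<tau>S q) \<eta> p (q SE) (q S) (q SW) Y (- X)"
    if "(Y, - X) \<in> trapeze \<eta>"
    using that inner[OF that] by (auto simp: eq intro: diag)
  show "q_plateau 1 1 qbar q X Y = \<T> (\<tau>N q) \<eta> p (q NW) (q N) (q NE) (- Y) X"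
    if "(- Y, X) \<in> trapeze \<eta>"
  proof -
    have "(Y, - X) \<notin> trapeze \<eta>" using neg[OF that] neg[of Y "- X"] by auto
    then show ?thesis
      using that inner[OF that] by (auto simp: eq intro: diag[OF that, simplified, symmetric])
  qed
  show "q_plateau 1 1 qbar q X Y = \<T> (\<tau>E q) \<eta> p (q NE) (q E) (q SE) (- X) (- Y)"
    if "(- X, - Y) \<in> trapeze \<eta>"
  proof -
    have "(X, Y) \<notin> trapeze \<eta>" using neg[OF that] neg[of X Y] by auto
    then show ?thesis
      using that inner[OF that]
      by (auto simp: eq intro: diag[of Y "- X", simplified] diag[OF that, simplified, symmetric])
  qed
qed

text \<open>
  What has to be known about the reconstruction in a cell of size \<open>1 \<times> 1\<close>: it is continuous, and its
  boundary values are the edge profiles. The profiles run from west to east and from south to north,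
  so that the two cells at an edge describe their common trace by the same parameter.
\<close>
definition conforming :: "(loc \<Rightarrow> real) \<Rightarrow> (real \<Rightarrow> real \<Rightarrow> real) \<Rightarrow> bool" where
  "conforming q f \<longleftrightarrow>
     continuous_on ({- 1 / 2..1 / 2} \<times> {- 1 / 2..1 / 2}) (\<lambda>(X, Y). f X Y) \<and>
     (\<forall>v \<in> {- 1 / 2..1 / 2}.
        f (- 1 / 2) v = edge_profile (\<tau>W q) (q SW) (q W) (q NW) v \<and>
        f (1 / 2) v = edge_profile (\<tau>E q) (q SE) (q E) (q NE) v \<and>
        f v (- 1 / 2) = edge_profile (\<tau>S q) (q SW) (q S) (q SE) v \<and>
        f v (1 / 2) = edge_profile (\<tau>N q) (q NW) (q N) (q NE) v)"

lemma conforming_q_pw: "conforming q (q_pw 1 1 qbar q)"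
  unfolding conforming_def by (intro conjI ballI continuous_q_pw q_pw_trace)

lemma conforming_q_plateau:
  assumes "min_val q < qbar" "qbar < max_val q"
  shows "conforming q (q_plateau 1 1 qbar q)"
proof -
  define \<eta> where "\<eta> = plateau_\<eta> qbar q"
  define p where "p = plateau_val qbar q \<eta>"
  have \<eta>: "0 < \<eta>" "\<eta> < 1 / 2" unfolding \<eta>_def using assms by (rule plateau_\<eta>_bounds)+
  note pieces = q_plateau_pieces[of qbar q, folded \<eta>_def, folded p_def, OF \<eta>]
  let ?F = "\<lambda>z. q_plateau 1 1 qbar q (fst z) (snd z)"
  let ?c = "{- 1 / 2..1 / 2} \<times> {- 1 / 2..1 / 2} :: (real \<times> real) set"
  define RP where "RP = {z :: real \<times> real. \<bar>fst z\<bar> \<le> 1 / 2 - \<eta> \<and> \<bar>snd z\<bar> \<le> 1 / 2 - \<eta>}"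
  define RW where "RW = {z. (fst z, snd z) \<in> trapeze \<eta>}"
  define RS where "RS = {z. (snd z, - fst z) \<in> trapeze \<eta>}"
  define RN where "RN = {z. (- snd z, fst z) \<in> trapeze \<eta>}"
  define RE where "RE = {z. (- fst z, - snd z) \<in> trapeze \<eta>}"
  have closed: "closed RP" "closed RW" "closed RS" "closed RN" "closed RE"
    unfolding RP_def RW_def RS_def RN_def RE_def trapeze_def mem_Collect_eq case_prod_conv
    by (intro closed_Collect_conj closed_Collect_le continuous_intros)+
  have "continuous_on RP ?F"
    by (rule continuous_on_eq [of _ "\<lambda>_. p"]) (auto simp: RP_def pieces)
  moreover have "continuous_on RW ?F"
    by (rule continuous_on_eq [OF continuous_on_\<T> [of RW fst snd]])
      (use \<eta> in \<open>auto simp: RW_def pieces trapeze_def intro!: continuous_intros\<close>)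
  moreover have "continuous_on RS ?F"
    by (rule continuous_on_eq [OF continuous_on_\<T> [of RS snd "\<lambda>z. - fst z"]])
      (use \<eta> in \<open>auto simp: RS_def pieces trapeze_def intro!: continuous_intros\<close>)
  moreover have "continuous_on RN ?F"
    by (rule continuous_on_eq [OF continuous_on_\<T> [of RN "\<lambda>z. - snd z" fst]])
      (use \<eta> in \<open>auto simp: RN_def pieces trapeze_def intro!: continuous_intros\<close>)
  moreover have "continuous_on RE ?F"
    by (rule continuous_on_eq [OF continuous_on_\<T> [of RE "\<lambda>z. - fst z" "\<lambda>z. - snd z"]])
      (use \<eta> in \<open>auto simp: RE_def pieces trapeze_def intro!: continuous_intros\<close>)
  ultimately have "continuous_on (RP \<union> RW \<union> RS \<union> RN \<union> RE) ?F"
    using closed by (intro continuous_on_closed_Un closed_Un)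
  moreover have "?c \<subseteq> RP \<union> RW \<union> RS \<union> RN \<union> RE"
  proof
    fix z assume "z \<in> ?c"
    then obtain X Y where z: "z = (X, Y)" and c: "- 1 / 2 \<le> X" "X \<le> 1 / 2" "- 1 / 2 \<le> Y" "Y \<le> 1 / 2"
      by auto
    \<comment> \<open>The diagonals cut the cell into four triangles; each is the union of a trapeze and a part
      of the plateau.\<close>
    have "X \<le> Y \<and> Y \<le> - X \<or> Y \<le> - X \<and> X \<ge> Y \<or> - Y \<le> X \<and> X \<le> Y \<or> - X \<le> Y \<and> Y \<le> X"
      by linarith
    then consider "X \<le> Y" "Y \<le> - X" | "Y \<le> - X" "Y \<le> X" | "- Y \<le> X" "X \<le> Y" | "- X \<le> Y" "Y \<le> X"
      by blast
    then show "z \<in> RP \<union> RW \<union> RS \<union> RN \<union> RE"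
    proof cases
      case 1
      then have "z \<in> RP \<or> z \<in> RW" using c by (auto simp: z RP_def RW_def trapeze_def abs_le_iff)
      then show ?thesis by blast
    next
      case 2
      then have "z \<in> RP \<or> z \<in> RS" using c by (auto simp: z RP_def RS_def trapeze_def abs_le_iff)
      then show ?thesis by blast
    next
      case 3
      then have "z \<in> RP \<or> z \<in> RN" using c by (auto simp: z RP_def RN_def trapeze_def abs_le_iff)
      then show ?thesis by blast
    next
      case 4
      then have "z \<in> RP \<or> z \<in> RE" using c by (auto simp: z RP_def RE_def trapeze_def abs_le_iff)
      then show ?thesis by blast
    qed
  qed
  ultimately have "continuous_on ?c ?F" by (rule continuous_on_subset)
  moreover have "q_plateau 1 1 qbar q (- 1 / 2) v = edge_profile (\<tau>W q) (q SW) (q W) (q NW) v"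
      "q_plateau 1 1 qbar q (1 / 2) v = edge_profile (\<tau>E q) (q SE) (q E) (q NE) v"
      "q_plateau 1 1 qbar q v (- 1 / 2) = edge_profile (\<tau>S q) (q SW) (q S) (q SE) v"
      "q_plateau 1 1 qbar q v (1 / 2) = edge_profile (\<tau>N q) (q NW) (q N) (q NE) v"
    if "v \<in> {- 1 / 2..1 / 2}" for v
  proof -
    have m: "- (1 / 2) = (- 1 / 2 :: real)" by simp
    have T: "(- 1 / 2, v) \<in> trapeze \<eta>" "(- 1 / 2, - v) \<in> trapeze \<eta>"
      using that \<eta> by (auto simp: trapeze_def)
    have "\<eta> \<noteq> 0" using \<eta> by simp
    note edge = \<T>_edge [OF this] edge_profile_reverse
    show "q_plateau 1 1 qbar q (- 1 / 2) v = edge_profile (\<tau>W q) (q SW) (q W) (q NW) v"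
      unfolding pieces(2) [OF T(1)] edge ..
    show "q_plateau 1 1 qbar q (1 / 2) v = edge_profile (\<tau>E q) (q SE) (q E) (q NE) v"
      unfolding pieces(5) [of "1 / 2" v, unfolded m, OF T(2)] edge ..
    show "q_plateau 1 1 qbar q v (- 1 / 2) = edge_profile (\<tau>S q) (q SW) (q S) (q SE) v"
      unfolding pieces(3) [of "- 1 / 2" v, OF T(2)] edge ..
    show "q_plateau 1 1 qbar q v (1 / 2) = edge_profile (\<tau>N q) (q NW) (q N) (q NE) v"
      unfolding pieces(4) [of "1 / 2" v, unfolded m, OF T(1)] edge ..
  qed
  ultimately show ?thesis unfolding conforming_def case_prod_beta by blast
qed

section \<open>The limited reconstruction in a cell\<close>

text \<open>
  Which of the two reconstructions is chosen depends on the cell and its data, but not on the point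
  \<open>(x, y)\<close>, and both are conforming.
\<close>
lemma q_recon_conforming:
  obtains f where "conforming q f"
    and "\<And>x y. q_recon \<Delta>x \<Delta>y qbar q x y = f (x / \<Delta>x) (y / \<Delta>y)"
proof (cases "\<exists>x y. q_recon \<Delta>x \<Delta>y qbar q x y \<noteq> q_pw \<Delta>x \<Delta>y qbar q x y")
  case True
  then have m: "min_val q < qbar" "qbar < max_val q"
    and eq: "q_recon \<Delta>x \<Delta>y qbar q x y = q_plateau \<Delta>x \<Delta>y qbar q x y" for x y
    by (auto simp: q_recon_def Let_def split: if_splits)
  then show ?thesis
    using that [OF conforming_q_plateau [OF m]] q_plateau_rescale by metis
next
  case False
  then show ?thesis
    using that [OF conforming_q_pw] q_pw_rescale by metis
qed

lemma q_recon_continuous: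
  assumes "\<Delta>x > 0" "\<Delta>y > 0"
  shows "continuous_on (ref_cell \<Delta>x \<Delta>y) (\<lambda>(x, y). q_recon \<Delta>x \<Delta>y qbar q x y)"
proof -
  obtain f where f: "conforming q f"
    and eq: "\<And>x y. q_recon \<Delta>x \<Delta>y qbar q x y = f (x / \<Delta>x) (y / \<Delta>y)"
    using q_recon_conforming [of q \<Delta>x \<Delta>y qbar] by blast
  let ?c = "{- 1 / 2..1 / 2} \<times> {- 1 / 2..1 / 2} :: (real \<times> real) set"
  let ?s = "\<lambda>z. (fst z / \<Delta>x, snd z / \<Delta>y)"
  have "continuous_on ?c (\<lambda>(X, Y). f X Y)" using f unfolding conforming_def by blast
  moreover have "continuous_on (ref_cell \<Delta>x \<Delta>y) ?s"
    using assms by (intro continuous_intros) auto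
  moreover have "?s ` ref_cell \<Delta>x \<Delta>y \<subseteq> ?c"
    using assms by (auto simp: ref_cell_def field_simps)
  ultimately have "continuous_on (ref_cell \<Delta>x \<Delta>y) (\<lambda>z. (\<lambda>(X, Y). f X Y) (?s z))"
    by (rule continuous_on_compose2)
  then show ?thesis by (simp add: eq case_prod_beta)
qed

lemma q_recon_trace:
  assumes "\<Delta>x > 0" "\<Delta>y > 0"
  shows "\<bar>y\<bar> \<le> \<Delta>y / 2 \<Longrightarrow> q_recon \<Delta>x \<Delta>y qbar q (- \<Delta>x / 2) y =
      edge_profile (\<tau>W q) (q SW) (q W) (q NW) (y / \<Delta>y)"
    and "\<bar>y\<bar> \<le> \<Delta>y / 2 \<Longrightarrow> q_recon \<Delta>x \<Delta>y qbar q (\<Delta>x / 2) y =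
      edge_profile (\<tau>E q) (q SE) (q E) (q NE) (y / \<Delta>y)"
    and "\<bar>x\<bar> \<le> \<Delta>x / 2 \<Longrightarrow> q_recon \<Delta>x \<Delta>y qbar q x (- \<Delta>y / 2) =
      edge_profile (\<tau>S q) (q SW) (q S) (q SE) (x / \<Delta>x)"
    and "\<bar>x\<bar> \<le> \<Delta>x / 2 \<Longrightarrow> q_recon \<Delta>x \<Delta>y qbar q x (\<Delta>y / 2) =
      edge_profile (\<tau>N q) (q NW) (q N) (q NE) (x / \<Delta>x)"
proof -
  obtain f where f: "conforming q f"
    and eq: "\<And>x y. q_recon \<Delta>x \<Delta>y qbar q x y = f (x / \<Delta>x) (y / \<Delta>y)"
    using q_recon_conforming [of q \<Delta>x \<Delta>y qbar] by blast
  have ends: "- d / 2 / d = - 1 / 2" "d / 2 / d = 1 / 2" if "d > 0" for d :: real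
    using that by simp_all
  have mem: "v / d \<in> {- 1 / 2..1 / 2}" if "d > 0" "\<bar>v\<bar> \<le> d / 2" for v d :: real
    using that by (auto simp: divide_simps abs_le_iff)
  note simps = eq ends[OF assms(1)] ends[OF assms(2)]
  show "q_recon \<Delta>x \<Delta>y qbar q (- \<Delta>x / 2) y =
      edge_profile (\<tau>W q) (q SW) (q W) (q NW) (y / \<Delta>y)"
    and "q_recon \<Delta>x \<Delta>y qbar q (\<Delta>x / 2) y =
      edge_profile (\<tau>E q) (q SE) (q E) (q NE) (y / \<Delta>y)" if "\<bar>y\<bar> \<le> \<Delta>y / 2"
    using f mem[OF assms(2) that] unfolding conforming_def simps by blast+
  show "q_recon \<Delta>x \<Delta>y qbar q x (- \<Delta>y / 2) =
      edge_profile (\<tau>S q) (q SW) (q S) (q SE) (x / \<Delta>x)"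
    and "q_recon \<Delta>x \<Delta>y qbar q x (\<Delta>y / 2) =
      edge_profile (\<tau>N q) (q NW) (q N) (q NE) (x / \<Delta>x)" if "\<bar>x\<bar> \<le> \<Delta>x / 2"
    using f mem[OF assms(1) that] unfolding conforming_def simps by blast+
qed

section \<open>Equidistant intervals\<close>

lemma equidistant_centers:
  fixes c :: "int \<Rightarrow> real"
  assumes "\<And>i. c (i + 1) = c i + d"
  shows "c i = c 0 + of_int i * d"
proof (induction i rule: int_induct [where k = 0])
  case (step1 i)
  then show ?case using assms[of i] by (simp add: algebra_simps)
next
  case (step2 i)
  then show ?case using assms[of "i - 1"] by (simp add: algebra_simps)
qed simp

lemma equidistant_cover:
  fixes c :: "int \<Rightarrow> real"
  assumes "d > 0" "\<And>i. c (i + 1) = c i + d"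
  obtains i where "x \<in> {c i - d / 2..c i + d / 2}"
proof
  define i where "i = round ((x - c 0) / d)"
  have "\<bar>of_int i - (x - c 0) / d\<bar> \<le> 1 / 2" unfolding i_def by (rule of_int_round_abs_le)
  then have "\<bar>of_int i * d - (x - c 0)\<bar> \<le> d / 2"
    using \<open>d > 0\<close> by (simp add: abs_le_iff field_simps)
  then show "x \<in> {c i - d / 2..c i + d / 2}"
    using equidistant_centers[of c d, OF assms(2), of i]
    by (simp only: atLeastAtMost_iff, intro conjI; linarith)
qed

lemma equidistant_adjacent:
  fixes c :: "int \<Rightarrow> real"
  assumes "d > 0" "\<And>i. c (i + 1) = c i + d"
    and "x \<in> {c i - d / 2..c i + d / 2}" "x \<in> {c k - d / 2..c k + d / 2}"
  shows "k = i \<or> k = i + 1 \<or> i = k + 1"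
proof -
  have "\<bar>of_int (k - i) * d\<bar> \<le> d"
    using assms(3,4) equidistant_centers[of c d, OF assms(2), of i] equidistant_centers[of c d, OF assms(2), of k]
    by (auto simp: abs_le_iff algebra_simps)
  then have "\<bar>of_int (k - i) :: real\<bar> \<le> 1" using \<open>d > 0\<close> by (simp add: abs_mult)
  then have "\<bar>k - i\<bar> \<le> 1" by linarith
  then show ?thesis by linarith
qed

lemma equidistant_locally_finite:
  fixes c :: "int \<Rightarrow> real"
  assumes "d > 0" "\<And>i. c (i + 1) = c i + d"
  shows "finite {i. {c i - d / 2..c i + d / 2} \<inter> {x - 1<..<x + 1} \<noteq> {}}"
proof (rule finite_subset)
  show "{i. {c i - d / 2..c i + d / 2} \<inter> {x - 1<..<x + 1} \<noteq> {}} \<subseteq>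
      {\<lfloor>(x - c 0 - 1) / d - 1 / 2\<rfloor>..\<lceil>(x - c 0 + 1) / d + 1 / 2\<rceil>}" (is "?L \<subseteq> _")
  proof
    fix i assume "i \<in> ?L"
    then obtain u where "c i - d / 2 \<le> u" "u \<le> c i + d / 2" "x - 1 < u" "u < x + 1" by auto
    then have "x - c 0 - 1 - d / 2 \<le> of_int i * d" "of_int i * d \<le> x - c 0 + 1 + d / 2"
      using equidistant_centers[of c d, OF assms(2), of i] by linarith+
    then have "(x - c 0 - 1) / d - 1 / 2 \<le> of_int i" "of_int i \<le> (x - c 0 + 1) / d + 1 / 2"
      using \<open>d > 0\<close> by (simp_all add: field_simps)
    then show "i \<in> {\<lfloor>(x - c 0 - 1) / d - 1 / 2\<rfloor>..\<lceil>(x - c 0 + 1) / d + 1 / 2\<rceil>}"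
      by (simp add: floor_le_iff le_ceiling_iff)
  qed
qed simp

section \<open>Gluing the cells\<close>

lemma cell_recon_continuous:
  assumes "\<Delta>x > 0" "\<Delta>y > 0"
  shows "continuous_on (grid_cell \<Delta>x \<Delta>y xc yc i j) (cell_recon \<Delta>x \<Delta>y xc yc qbar qc qv qh i j)"
proof -
  let ?g = "\<lambda>(x, y). q_recon \<Delta>x \<Delta>y (qbar i j) (cell_values qc qv qh i j) x y"
  have "continuous_on (grid_cell \<Delta>x \<Delta>y xc yc i j) (\<lambda>z. ?g (fst z - xc i, snd z - yc j))"
    by (intro continuous_on_compose2 [OF q_recon_continuous [OF assms]] continuous_intros)
      (auto simp: grid_cell_def ref_cell_def)
  then show ?thesis by (simp add: cell_recon_def case_prod_beta)
qed

lemma cell_recon_east_neighbour: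
  assumes "\<Delta>x > 0" "\<Delta>y > 0" "\<And>i. xc (i + 1) = xc i + \<Delta>x"
    and "z \<in> grid_cell \<Delta>x \<Delta>y xc yc i j" "z \<in> grid_cell \<Delta>x \<Delta>y xc yc (i + 1) j"
  shows "cell_recon \<Delta>x \<Delta>y xc yc qbar qc qv qh i j z =
    cell_recon \<Delta>x \<Delta>y xc yc qbar qc qv qh (i + 1) j z"
proof -
  obtain x y where z: "z = (x, y)" by (cases z)
  have x: "x - xc i = \<Delta>x / 2" "x - xc (i + 1) = - \<Delta>x / 2" and y: "\<bar>y - yc j\<bar> \<le> \<Delta>y / 2"
    using assms(3) [of i] assms(4,5)
    unfolding z grid_cell_def mem_Times_iff atLeastAtMost_iff fst_conv snd_conv by linarith+
  show ?thesis
    unfolding z cell_recon_def case_prod_conv x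
    by (simp only: q_recon_trace [OF assms(1,2)] y) (simp add: cell_values_def \<tau>E_def \<tau>W_def)
qed

lemma cell_recon_north_neighbour:
  assumes "\<Delta>x > 0" "\<Delta>y > 0" "\<And>j. yc (j + 1) = yc j + \<Delta>y"
    and "z \<in> grid_cell \<Delta>x \<Delta>y xc yc i j" "z \<in> grid_cell \<Delta>x \<Delta>y xc yc i (j + 1)"
  shows "cell_recon \<Delta>x \<Delta>y xc yc qbar qc qv qh i j z =
    cell_recon \<Delta>x \<Delta>y xc yc qbar qc qv qh i (j + 1) z"
proof -
  obtain x y where z: "z = (x, y)" by (cases z)
  have y: "y - yc j = \<Delta>y / 2" "y - yc (j + 1) = - \<Delta>y / 2" and x: "\<bar>x - xc i\<bar> \<le> \<Delta>x / 2"
    using assms(3) [of j] assms(4,5)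
    unfolding z grid_cell_def mem_Times_iff atLeastAtMost_iff fst_conv snd_conv by linarith+
  show ?thesis
    unfolding z cell_recon_def case_prod_conv y
    by (simp only: q_recon_trace [OF assms(1,2)] x) (simp add: cell_values_def \<tau>N_def \<tau>S_def)
qed

text \<open>
  A point common to two cells also lies in the cell \<open>(k, j)\<close>, as cells are products of intervals.
  Two steps across edges therefore suffice, even for cells that only share a corner.
\<close>
lemma cell_recon_agree:
  assumes \<Delta>: "\<Delta>x > 0" "\<Delta>y > 0"
    and grid: "\<And>i. xc (i + 1) = xc i + \<Delta>x" "\<And>j. yc (j + 1) = yc j + \<Delta>y"
    and z: "z \<in> grid_cell \<Delta>x \<Delta>y xc yc i j" "z \<in> grid_cell \<Delta>x \<Delta>y xc yc k l"
  shows "cell_recon \<Delta>x \<Delta>y xc yc qbar qc qv qh i j z =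
    cell_recon \<Delta>x \<Delta>y xc yc qbar qc qv qh k l z"
proof -
  have z': "z \<in> grid_cell \<Delta>x \<Delta>y xc yc k j"
    using z by (auto simp: grid_cell_def)
  have "k = i \<or> k = i + 1 \<or> i = k + 1"
    using z by (intro equidistant_adjacent [of \<Delta>x xc "fst z", OF \<Delta>(1) grid(1)]) (auto simp: grid_cell_def)
  then have "cell_recon \<Delta>x \<Delta>y xc yc qbar qc qv qh i j z =
      cell_recon \<Delta>x \<Delta>y xc yc qbar qc qv qh k j z"
    using cell_recon_east_neighbour [of \<Delta>x \<Delta>y xc, OF \<Delta> grid(1)] z(1) z' by metis
  moreover have "l = j \<or> l = j + 1 \<or> j = l + 1"
    using z by (intro equidistant_adjacent [of \<Delta>y yc "snd z", OF \<Delta>(2) grid(2)]) (auto simp: grid_cell_def)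
  then have "cell_recon \<Delta>x \<Delta>y xc yc qbar qc qv qh k j z =
      cell_recon \<Delta>x \<Delta>y xc yc qbar qc qv qh k l z"
    using cell_recon_north_neighbour [of \<Delta>x \<Delta>y yc, OF \<Delta> grid(2)] z(2) z' by metis
  ultimately show ?thesis by simp
qed

text \<open>
  Any selection of a cell for each point defines the function, by agreement on overlaps; local
  finiteness of the closed cover makes it continuous. As the cells cover the plane, its values are
  prescribed everywhere, which gives uniqueness.
\<close>
theorem theorem3p2:
  fixes \<Delta>x \<Delta>y :: real
    and xc yc :: "int \<Rightarrow> real"
    and qbar qc qv qh :: "int \<Rightarrow> int \<Rightarrow> real"
  assumes "\<Delta>x > 0" and "\<Delta>y > 0"
    and "\<And>i. xc (i + 1) = xc i + \<Delta>x"
    and "\<And>j. yc (j + 1) = yc j + \<Delta>y"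
  shows "(\<forall>i j k l. \<forall>z \<in> grid_cell \<Delta>x \<Delta>y xc yc i j \<inter> grid_cell \<Delta>x \<Delta>y xc yc k l.
            cell_recon \<Delta>x \<Delta>y xc yc qbar qc qv qh i j z = cell_recon \<Delta>x \<Delta>y xc yc qbar qc qv qh k l z)
       \<and> (\<exists>!f :: real \<times> real \<Rightarrow> real.
            (\<forall>i j. \<forall>z \<in> grid_cell \<Delta>x \<Delta>y xc yc i j. f z = cell_recon \<Delta>x \<Delta>y xc yc qbar qc qv qh i j z)
            \<and> continuous_on UNIV f)"
proof
  define R where "R = (\<lambda>(i, j). cell_recon \<Delta>x \<Delta>y xc yc qbar qc qv qh i j)"
  define C where "C = (\<lambda>(i, j). grid_cell \<Delta>x \<Delta>y xc yc i j)"
  have agree: "R p z = R p' z" if "z \<in> C p" "z \<in> C p'" for p p' z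
    using that by (cases p; cases p')
      (auto simp: R_def C_def intro: cell_recon_agree [of \<Delta>x \<Delta>y xc yc, OF assms])
  have cover: "\<exists>p. z \<in> C p" for z
  proof -
    obtain i where "fst z \<in> {xc i - \<Delta>x / 2..xc i + \<Delta>x / 2}"
      using equidistant_cover [of \<Delta>x xc, OF assms(1,3)] .
    moreover obtain j where "snd z \<in> {yc j - \<Delta>y / 2..yc j + \<Delta>y / 2}"
      using equidistant_cover [of \<Delta>y yc, OF assms(2,4)] .
    ultimately have "z \<in> C (i, j)" by (auto simp: C_def grid_cell_def mem_Times_iff)
    then show ?thesis ..
  qed
  have closed: "closed (C p)" for p
    by (cases p) (simp add: C_def grid_cell_def closed_Times)
  have cont: "continuous_on (C p) (R p)" for p
    using cell_recon_continuous [OF assms(1,2)] by (cases p) (simp add: C_def R_def)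
  have locally_finite: "\<exists>V. open V \<and> z \<in> V \<and> finite {p. C p \<inter> V \<noteq> {}}" for z
  proof (intro exI conjI)
    let ?V = "{fst z - 1<..<fst z + 1} \<times> {snd z - 1<..<snd z + 1}"
    show "open ?V" by (intro open_Times open_greaterThanLessThan)
    show "z \<in> ?V" by (simp add: mem_Times_iff)
    have "{p. C p \<inter> ?V \<noteq> {}} \<subseteq>
        {i. {xc i - \<Delta>x / 2..xc i + \<Delta>x / 2} \<inter> {fst z - 1<..<fst z + 1} \<noteq> {}} \<times>
        {j. {yc j - \<Delta>y / 2..yc j + \<Delta>y / 2} \<inter> {snd z - 1<..<snd z + 1} \<noteq> {}}"
      unfolding C_def grid_cell_def by fastforce
    then show "finite {p. C p \<inter> ?V \<noteq> {}}"
      by (rule finite_subset)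
        (intro finite_cartesian_product equidistant_locally_finite assms)
  qed
  obtain pick where pick: "\<And>z. z \<in> C (pick z)" using cover by metis
  define f where "f z = R (pick z) z" for z
  have f: "f z = R p z" if "z \<in> C p" for z p
    unfolding f_def using pick that by (rule agree)
  have "continuous_map euclidean euclidean f"
  proof (rule pasting_lemma_locally_finite [of _ UNIV C _ R])
    show "\<exists>V. openin euclidean V \<and> z \<in> V \<and> finite {p \<in> UNIV. C p \<inter> V \<noteq> {}}" for z
      using locally_finite [of z] by simp
    show "closedin euclidean (C p)" "continuous_map (subtopology euclidean (C p)) euclidean (R p)" for p
      using closed cont by simp_all
    show "R p z = R p' z" if "z \<in> topspace euclidean \<inter> C p \<inter> C p'" for p p' z
      using agree that by blast
    show "\<exists>p. p \<in> UNIV \<and> z \<in> C p \<and> f z = R p z" for z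
      using pick f by blast
  qed
  then have "continuous_on UNIV f" by simp
  show "\<forall>i j k l. \<forall>z \<in> grid_cell \<Delta>x \<Delta>y xc yc i j \<inter> grid_cell \<Delta>x \<Delta>y xc yc k l.
      cell_recon \<Delta>x \<Delta>y xc yc qbar qc qv qh i j z = cell_recon \<Delta>x \<Delta>y xc yc qbar qc qv qh k l z"
    using cell_recon_agree [of \<Delta>x \<Delta>y xc yc, OF assms] by blast
  show "\<exists>!f :: real \<times> real \<Rightarrow> real.
      (\<forall>i j. \<forall>z \<in> grid_cell \<Delta>x \<Delta>y xc yc i j. f z = cell_recon \<Delta>x \<Delta>y xc yc qbar qc qv qh i j z)
      \<and> continuous_on UNIV f"
  proof (rule ex1I [of _ f])
    show "(\<forall>i j. \<forall>z \<in> grid_cell \<Delta>x \<Delta>y xc yc i j. f z = cell_recon \<Delta>x \<Delta>y xc yc qbar qc qv qh i j z)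
        \<and> continuous_on UNIV f"
      using f [of _ "(_, _)"] \<open>continuous_on UNIV f\<close> by (simp add: C_def R_def)
  next
    fix g :: "real \<times> real \<Rightarrow> real"
    assume g: "(\<forall>i j. \<forall>z \<in> grid_cell \<Delta>x \<Delta>y xc yc i j.
        g z = cell_recon \<Delta>x \<Delta>y xc yc qbar qc qv qh i j z) \<and> continuous_on UNIV g"
    show "g = f"
    proof
      fix z
      obtain i j where "z \<in> C (i, j)" using cover [of z] by auto
      then show "g z = f z" using f [of z "(i, j)"] g by (simp add: C_def R_def)
    qed
  qed
qed

end
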